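(* Let $m\equiv 2 \pmod 4$, let $\mathbb M=\mathbb F_{2^m}$ and let $\mathbb K=\mathbb F_{2^{m/2}}\subset\mathbb M$, with $Q=2^{m/2}$. Let $1\le k\le m-1$ with $\gcd(k,m)=1$, and put $q=2^k$, $r=qQ=2^{k+m/2}$. Let $B\in\mathbb M^\times$ be a non-cube (i.e. $B\in\mathbb M^\times\setminus(\mathbb M^\times)^3$) and let $a\in\mathbb K^\times$ be such that $B^{q+r}\neq a^{q+1}$. Define $F:\mathbb M\times\mathbb M\to\mathbb M\times\mathbb M$ by $$F(x,y)=\left(x^{q+1}+By^{q+1},\; x^{r}y+\frac{a}{B}\,xy^{r}\right).$$ Then $F$ is APN.
   Context: A function $F$ from a finite-dimensional $\mathbb F_2$-vector space $V$ to itself is almost perfect nonlinear (APN) if for every nonzero $c\in V$ and every $d\in V$ the equation $F(z)+F(z+c)=d$ has zero or two solutions $z\in V$. Here $V=\mathbb M\times\mathbb M$. *)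

theory Defs
  imports
    "HOL-Algebra.Algebraic_Closure_Type"
    "HOL-Library.Cardinality"
    "HOL-Library.Product_Plus"
begin

(* Meant for finite elementary abelian 2-groups, i.e. the additive groups of finite-dimensional
   vector spaces over the field with two elements.  The scalar multiplication is determined by
   the additive structure and plays no role in the notion.  The sort constraint to finite types
   matters: card of an infinite solution set would be 0. *)
definition apn :: "('v::{ab_group_add,finite} \<Rightarrow> 'v) \<Rightarrow> bool" where
  "apn F \<longleftrightarrow> (\<forall>c d. c \<noteq> 0 \<longrightarrow> card {z. F z + F (z + c) = d} \<in> {0, 2})"

end

theory Submission
  imports Defs
begin

text \<open>
  Since \<open>F\<close> is quadratic, it is APN iff the polarization \<open>F (z + c) + F z + F c\<close> vanishes only for
  \<open>z \<in> {0, c}\<close>. As \<open>k\<close> and \<open>m div 2\<close> are odd, \<open>q + 1\<close>, \<open>Q + 1\<close> and \<open>r - 1\<close> are divisible by 3, and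
  all elements of the subfield \<open>K\<close> are cubes. For \<open>c\<close> on a coordinate axis, a solution
  outside \<open>{0, c}\<close> would make \<open>B\<close> a cube. For \<open>c = (u, v)\<close> with \<open>u\<close> and \<open>v\<close> nonzero, put \<open>z = (u \<xi>, v \<eta>)\<close> and
  \<open>w = u / v\<close>; the two equations become
  \<open>A (\<xi>^q + \<xi>) = \<eta>^q + \<eta>\<close> and \<open>e (\<xi>^r + \<eta>) = A (\<xi> + \<eta>^r)\<close> with \<open>A = w^(q + 1) / B\<close> not a cube and
  \<open>e = w^(q + r) / a\<close> in \<open>K\<close>. Combining them with their conjugates under \<open>x \<mapsto> x^Q\<close> gives
  \<open>\<xi>^q = \<xi>\<close> and \<open>\<eta> = \<xi>^Q\<close>, and \<open>\<xi>^q = \<xi>\<close> only for \<open>\<xi> \<in> {0, 1}\<close> because \<open>gcd k m = 1\<close>.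
\<close>

section \<open>Quadratic maps in characteristic 2 and their polarization\<close>

text \<open>Each derivative in direction \<open>c\<close> is \<open>z \<mapsto> F c + P z c\<close>,
  so its nonempty fibres are cosets of the kernel of the additive map
  \<open>\<lambda>z. P z c\<close>, which is \<open>{0, c}\<close>.\<close>

lemma apn_if_polarization_kernel_trivial:
  fixes F :: "'v::{ab_group_add,finite} \<Rightarrow> 'v" and P :: "'v \<Rightarrow> 'v \<Rightarrow> 'v"
  assumes char2: "\<And>x::'v. x + x = 0"
    and polar: "\<And>z h. F (z + h) = F z + F h + P z h"
    and additive: "\<And>z h c. P (z + h) c = P z c + P h c"
    and kernel: "\<And>c z. c \<noteq> 0 \<Longrightarrow> P z c = 0 \<Longrightarrow> z = 0 \<or> z = c"
  shows "apn F"
  unfolding apn_def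
proof (intro allI impI)
  fix c d :: 'v
  assume c: "c \<noteq> 0"
  have derivative: "F z + F (z + c) = F c + P z c" for z
  proof -
    have "F z + F (z + c) = (F z + F z) + F c + P z c"
      using polar[of z c] by (simp add: add.assoc)
    then show ?thesis by (simp add: char2)
  qed
  have Pcc: "P c c = 0"
  proof -
    have "P 0 c = 0" using additive[of 0 0 c] by simp
    moreover have "F 0 = 0" using polar[of 0 0] additive[of 0 0 0] by simp
    ultimately show ?thesis using polar[of c c] char2 by simp
  qed
  show "card {z. F z + F (z + c) = d} \<in> {0, 2}"
  proof (cases "{z. F z + F (z + c) = d} = {}")
    case False
    then obtain z where z: "F c + P z c = d" unfolding derivative by blast
    have "{z. F z + F (z + c) = d} = {z, z + c}"
    proof (intro equalityI subsetI)
      fix w assume "w \<in> {z. F z + F (z + c) = d}"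
      then have Pw: "P w c = P z c"
        using z unfolding derivative by (metis add_left_cancel mem_Collect_eq)
      then have "P (w + z) c = 0"
        by (simp add: additive char2)
      then have "w + z = 0 \<or> w + z = c" using kernel c by blast
      then show "w \<in> {z, z + c}"
        by (metis add.commute add.left_commute add_0_right char2 insertCI)
    qed (use z in \<open>auto simp: derivative additive Pcc\<close>)
    then show ?thesis using c by simp
  qed simp
qed

section \<open>The system formed with its conjugates\<close>

text \<open>
  The maps \<open>s\<close> and \<open>b\<close> stand for the powers \<open>q\<close> and \<open>Q\<close>. With \<open>S = s \<xi> + \<xi>\<close> and
  \<open>T = b \<xi> + \<eta>\<close>, eliminating \<open>S\<close> gives \<open>(A * b A + e) * s T = (1 + e) * A * b T\<close>, so the
  hypothesis \<open>noncube\<close> forces \<open>T = 0\<close> unless \<open>A * b A = e\<close>; the latter case is where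
  \<open>generic\<close> enters, by excluding \<open>e = 1\<close>.
\<close>

lemma conjugate_system_trivial:
  fixes s b :: "'a::field \<Rightarrow> 'a" and A e \<xi> \<eta> :: 'a
  assumes char2: "(2::'a) = 0"
    and s_add: "\<And>x y. s (x + y) = s x + s y"
    and s_zero: "\<And>x. s x = 0 \<longleftrightarrow> x = 0"
    and b_add: "\<And>x y. b (x + y) = b x + b y" and b_mult: "\<And>x y. b (x * y) = b x * b y"
    and b_b: "\<And>x. b (b x) = x" and b_s: "\<And>x. b (s x) = s (b x)"
    and b_e: "b e = e" and e: "e \<noteq> 0"
    and generic: "s (A * b A) \<noteq> s e * e"
    and noncube: "\<And>t z. b t = t \<Longrightarrow> A * t * b z = s z \<Longrightarrow> z = 0"
    and eq1: "A * (s \<xi> + \<xi>) = s \<eta> + \<eta>"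
    and eq2: "e * (s (b \<xi>) + \<eta>) = A * (\<xi> + s (b \<eta>))"
  shows "s \<xi> = \<xi>" "\<eta> = b \<xi>"
proof -
  define S where "S = s \<xi> + \<xi>"
  define T where "T = b \<xi> + \<eta>"
  have b0: "b 0 = 0" using b_add[of 0 0] by (metis add_0_right add_left_cancel)
  have b1: "b 1 = 1" using b_mult[of "b 1" 1] b_b by (metis mult.left_neutral mult_1_right)
  have dbl: "x + x = 0" for x :: 'a using char2 by (metis mult_2 mult_zero_left)
  have dbl': "x + (x + y) = y" for x y :: 'a using dbl[of x] by (simp flip: add.assoc)
  have bS: "b S = s (b \<xi>) + b \<xi>" by (simp add: S_def b_add b_s)
  have bT: "b T = \<xi> + b \<eta>" by (simp add: T_def b_add b_b)
  have sT: "s T = s (b \<xi>) + s \<eta>" by (simp add: T_def s_add)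
  have eq1b: "b A * b S = s (b \<eta>) + b \<eta>"
    by (metis S_def b_add b_mult b_s eq1)
  have r1: "s T + T = b S + A * S"
    unfolding sT bS eq1[folded S_def] by (simp add: T_def add_ac)
  \<comment> \<open>The brackets of \<open>eq2\<close> are \<open>b S + T\<close> and
    \<open>b T + b A * b S\<close>; \<open>r3\<close> below is the conjugate of this
    relation.\<close>
  have r2: "e * T + A * b T = (A * b A + e) * b S"
  proof -
    have "b S + T = s (b \<xi>) + \<eta>"
      unfolding bS T_def by (simp add: add_ac dbl')
    moreover have "b T + b A * b S = \<xi> + s (b \<eta>)"
      unfolding eq1b bT by (simp add: add_ac dbl')
    ultimately have "e * (b S + T) = A * (b T + b A * b S)" using eq2 by simp
    then have "e * b S + (e * b S + e * T) + A * b T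
        = e * b S + (A * b T + A * (b A * b S)) + A * b T"
      by (simp only: distrib_left)
    then show ?thesis by (simp add: algebra_simps dbl dbl')
  qed
  have r3: "e * b T + b A * T = (A * b A + e) * S"
  proof -
    have "b (e * T + A * b T) = b ((A * b A + e) * b S)" using r2 by simp
    then show ?thesis by (simp add: b_add b_mult b_b b_e mult.commute)
  qed
  \<comment> \<open>Multiply \<open>r1\<close> by \<open>A * b A + e\<close> and substitute
    \<open>r2\<close> and \<open>r3\<close>; the multiples of \<open>T\<close> cancel.\<close>
  have r4: "(A * b A + e) * s T = (1 + e) * A * b T"
  proof -
    have "s T = b S + A * S + T" using r1 by (metis add.assoc add_0_right dbl)
    then have "(A * b A + e) * s T
        = (A * b A + e) * b S + A * ((A * b A + e) * S) + (A * b A + e) * T"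
      by (simp add: algebra_simps)
    also have "\<dots> = (e * T + A * b T) + A * (e * b T + b A * T) + (A * b A + e) * T"
      using r2 r3 by simp
    finally show ?thesis by (simp add: algebra_simps dbl dbl')
  qed
  have "T = 0 \<and> S = 0"
  proof (cases "A * b A + e = 0")
    case False
    \<comment> \<open>This quotient is fixed by \<open>b\<close>, so it can be the \<open>t\<close>
      of \<open>noncube\<close>.\<close>
    have "b ((1 + e) / (A * b A + e)) * (A * b A + e) = 1 + e"
    proof -
      have "b ((1 + e) / (A * b A + e)) * b (A * b A + e) = b (1 + e)"
        using False by (simp flip: b_mult)
      then show ?thesis by (simp add: b_add b_mult b_b b_e b1 mult.commute)
    qed
    then have "b ((1 + e) / (A * b A + e)) = (1 + e) / (A * b A + e)"
      using False by (simp add: field_simps)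
    moreover have "A * ((1 + e) / (A * b A + e)) * b T = s T"
      using r4 False by (simp add: field_simps)
    ultimately have "T = 0" by (rule noncube)
    then show ?thesis using r3 b0 False by simp
  next
    case True
    then have N: "A * b A = e" using dbl by (metis add_right_cancel)
    \<comment> \<open>When \<open>A * b A = e\<close>, \<open>generic\<close> reads
      \<open>s e \<noteq> s e * e\<close>.\<close>
    have e1: "e \<noteq> 1"
      using generic N by auto
    have T: "T = 0"
    proof (rule ccontr)
      assume "T \<noteq> 0"
      have "e * T = A * b T" and "e * b T = b A * T"
        using r2 r3 True dbl by (metis add_right_cancel mult_zero_left)+
      then have "e * e * T = e * T"
        using N by (metis mult.assoc mult.left_commute)
      then show False using e e1 \<open>T \<noteq> 0\<close> by simp
    qed
    have "S = 0"
    proof (rule ccontr)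
      assume "S \<noteq> 0"
      have "b S = A * S" using r1 T s_zero dbl by (metis add.right_neutral add_right_cancel)
      then have "S = b A * b S" using b_mult b_b by metis
      then have "S = e * S" using N \<open>b S = A * S\<close> by (metis mult.assoc mult.commute)
      then show False using e1 \<open>S \<noteq> 0\<close> by simp
    qed
    with T show ?thesis by blast
  qed
  then show "s \<xi> = \<xi>" "\<eta> = b \<xi>"
    using dbl unfolding S_def T_def by (metis add_right_cancel)+
qed

section \<open>Power maps on finite fields\<close>

text \<open>Multiplication by a nonzero \<open>x\<close> permutes \<open>K - {0}\<close>; compare
  the products over this set.\<close>

lemma power_card_mult_closed:
  fixes x :: "'a::idom"
  assumes fin: "finite K" and zero: "0 \<in> K" and x: "x \<in> K"
    and closed: "\<And>y z. y \<in> K \<Longrightarrow> z \<in> K \<Longrightarrow> y * z \<in> K"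
  shows "x ^ card K = x"
proof (cases "x = 0")
  case True
  then show ?thesis using fin zero card_gt_0_iff[of K] by auto
next
  case False
  let ?U = "K - {0}"
  have inj: "inj_on ((*) x) ?U" using False by (auto simp: inj_on_def)
  have image: "(*) x ` ?U = ?U"
    by (rule card_subset_eq) (use fin x False closed inj in \<open>auto simp: card_image\<close>)
  have "\<Prod>?U = (\<Prod>y\<in>?U. x * y)"
    by (rule prod.reindex_bij_betw[symmetric]) (use inj image in \<open>simp add: bij_betw_def\<close>)
  also have "\<dots> = x ^ card ?U * \<Prod>?U"
    by (simp add: prod.distrib)
  finally have "x ^ card ?U = 1"
    using fin by simp
  moreover have "card K = Suc (card ?U)"
    using fin zero by (rule card.remove)
  ultimately show ?thesis by simp
qed

lemma power_two_power_iterate: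
  fixes x :: "'a::monoid_mult"
  assumes "x ^ (2 ^ j) = x"
  shows "x ^ (2 ^ (j * i)) = x"
proof (induction i)
  case (Suc i)
  have "x ^ (2 ^ (j * Suc i)) = (x ^ (2 ^ j)) ^ (2 ^ (j * i))"
    by (simp add: power_add power_mult)
  then show ?case using assms Suc by simp
qed simp

text \<open>By Bezout some multiple of \<open>k\<close> exceeds a multiple of \<open>m\<close> by 1,
  so \<open>x\<close> is fixed by squaring.\<close>

lemma frobenius_fixed_coprime:
  fixes x :: "'a::idom"
  assumes k: "x ^ (2 ^ k) = x" and m: "x ^ (2 ^ m) = x" and "gcd k m = 1" "k \<noteq> 0"
  shows "x = 0 \<or> x = 1"
proof -
  obtain i j where ij: "k * i = m * j + 1"
    using bezout_nat[of k m] assms by auto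
  have "x = x ^ (2 ^ (m * j + 1))"
    using power_two_power_iterate[OF k, of i] ij by simp
  also have "\<dots> = (x ^ (2 ^ (m * j))) ^ 2"
    by (simp only: power_add power_mult power_one_right)
  also have "\<dots> = x ^ 2"
    using power_two_power_iterate[OF m, of j] by simp
  finally have "x * (x - 1) = 0" by (simp add: algebra_simps power2_eq_square)
  then show ?thesis by simp
qed

lemma two_power_odd_mod_3:
  assumes "odd j"
  shows "(2::nat) ^ j mod 3 = 2"
proof -
  obtain i where j: "j = 2 * i + 1" using assms by (rule oddE)
  have "(4::nat) ^ i mod 3 = 1"
    using power_mod[of "4::nat" 3 i] by simp
  moreover have "(2::nat) ^ j = 4 ^ i * 2" by (simp add: j power_mult)
  ultimately show ?thesis by (simp add: mod_mult_left_eq[symmetric])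
qed

lemma power_cube_of_dvd:
  fixes x :: "'a::comm_monoid_mult"
  assumes "3 dvd n"
  shows "\<exists>y. x ^ n = y ^ 3"
  using assms by (metis dvd_def mult.commute power_mult)

text \<open>Translation by 1 permutes the field; comparing sums shows that the cardinality vanishes
  in it.\<close>

lemma char_2_if_card_two_power:
  assumes "CARD('a::{field,finite}) = 2 ^ m"
  shows "CHAR('a) = 2"
proof -
  have "(\<Sum>x\<in>(UNIV::'a set). x + 1) = (\<Sum>x\<in>UNIV. x)"
    by (rule sum.reindex_bij_witness[of _ "\<lambda>x. x - 1" "\<lambda>x. x + 1"]) auto
  then have "of_nat (CARD('a)) = (0::'a)" by (simp add: sum.distrib)
  then have "CHAR('a) dvd 2 ^ m" using assms of_nat_eq_0_iff_char_dvd by metis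
  moreover have "prime CHAR('a)"
    using prime_CHAR_semidom finite_imp_CHAR_pos[where ?'a = 'a] by simp
  ultimately show ?thesis
    by (metis prime_dvd_power primes_dvd_imp_eq two_is_prime_nat)
qed

theorem theorem3p3:
  fixes m k q Q r :: nat
    and a B :: "'a::{field,finite}"
    and K :: "'a set"
    and F :: "'a \<times> 'a \<Rightarrow> 'a \<times> 'a"
  assumes "m mod 4 = 2"
    and "CARD('a) = 2 ^ m"
    and "Q = 2 ^ (m div 2)"
    and "subfield K (ring_of_type_algebra :: 'a ring)"
    and "card K = Q"
    and "1 \<le> k" and "k \<le> m - 1" and "gcd k m = 1"
    and "q = 2 ^ k" and "r = q * Q"
    and "B \<noteq> 0" and "B \<notin> {x ^ 3 | x. x \<noteq> 0}"
    and "a \<in> K" and "a \<noteq> 0"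
    and "B ^ (q + r) \<noteq> a ^ (q + 1)"
    and "F = (\<lambda>(x, y). (x ^ (q + 1) + B * y ^ (q + 1), x ^ r * y + (a / B) * (x * y ^ r)))"
  shows "apn F"
proof -
  have B0: "B \<noteq> 0" and a0: "a \<noteq> 0" by fact+
  have char: "CHAR('a) = 2" using assms(2) by (rule char_2_if_card_two_power)
  have two: "(2::'a) = 0" using of_nat_CHAR[where ?'a = 'a] unfolding char by simp
  have dbl: "x + x = 0" for x :: 'a using two by (metis mult_2 mult_zero_left)
  have eq_if_sum_0: "x = y" if "x + y = 0" for x y :: 'a
    using that dbl by (metis add_right_cancel)
  have add_pow: "(x + y) ^ (2 ^ j) = x ^ (2 ^ j) + y ^ (2 ^ j)" for x y :: 'a and j
    by (rule freshmans_dream') (simp_all add: char)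
  have "r = 2 ^ (k + m div 2)" using assms by (simp add: power_add)
  then have add_q: "(x + y) ^ q = x ^ q + y ^ q" and add_Q: "(x + y) ^ Q = x ^ Q + y ^ Q"
    and add_r: "(x + y) ^ r = x ^ r + y ^ r" for x y :: 'a
    using add_pow assms(3,9) by auto
  have pos: "q > 0" "Q > 0" "r > 0" using assms by auto
  have fix_m: "x ^ (2 ^ m) = x" for x :: 'a
    using power_card_mult_closed[of UNIV x] assms(2) by simp
  have fix_q: "x = 0 \<or> x = 1" if "x ^ q = x" for x :: 'a
    using frobenius_fixed_coprime[of x k m] that fix_m assms by simp
  have "m = m div 2 + m div 2" using assms(1) by presburger
  then have "2 ^ m = Q * Q" by (metis assms(3) power_add)
  then have QQ: "(x ^ Q) ^ Q = x" for x :: 'a using fix_m by (metis power_mult)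
  have aQ: "a ^ Q = a"
  proof -
    have sr: "subring K (ring_of_type_algebra :: 'a ring)"
      using assms(4) subfieldE(1) by blast
    show ?thesis
      using power_card_mult_closed[of K a] subringE(2,6)[OF sr] assms(5,13)
      by (simp add: ring_of_type_algebra_def)
  qed

  \<comment> \<open>Exponents modulo 3 and cubes\<close>
  have "odd k" using assms(1,8) by (metis even_zero gcd_greatest dvd_1_left
        mod_mod_cancel dvd_mod_iff nat_dvd_1_iff_1 even_numeral odd_one)
  have "odd (m div 2)" using assms(1) by presburger
  have q3: "q mod 3 = 2" and Q3: "Q mod 3 = 2"
    using two_power_odd_mod_3 \<open>odd k\<close> \<open>odd (m div 2)\<close> assms(3,9) by auto
  have r3: "r mod 3 = 1" unfolding assms(10) using q3 Q3 by (simp add: mod_mult_eq[symmetric, of q Q])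
  \<comment> \<open>Zero counts as a cube, so \<open>cube_K\<close> covers all of \<open>K\<close>;
    \<open>B\<close> is nonzero and stays a non-cube.\<close>
  define cube where "cube x \<longleftrightarrow> (\<exists>y. x = y ^ 3)" for x :: 'a
  have B_not_cube: "\<not> cube B" using assms(11,12) by (auto simp: cube_def)
  have cube_mult: "cube (x * y)" if "cube x" "cube y" for x y
    using that unfolding cube_def by (metis power_mult_distrib)
  have cube_div: "cube (x / y)" if "cube x" "cube y" for x y
    using that unfolding cube_def by (metis power_divide)
  have cube_pow: "cube (x ^ n)" if "3 dvd n" for x n
    using power_cube_of_dvd[OF that] by (simp add: cube_def)
  have cube_K: "cube t" if "t ^ Q = t" for t
  proof (cases "t = 0")
    case False
    \<comment> \<open>The exponent \<open>2 * Q - 1\<close> fixes \<open>t\<close> and is divisible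
      by 3 because \<open>Q mod 3 = 2\<close>.\<close>
    have "t ^ (2 * Q - 1) * t = t ^ (2 * Q)"
      using pos by (metis Suc_diff_1 mult_pos_pos power_Suc2 zero_less_numeral)
    also have "\<dots> = t * t" using that by (metis mult.commute power2_eq_square power_mult)
    finally have "t ^ (2 * Q - 1) = t" using False by simp
    moreover have "3 dvd 2 * Q - 1" using Q3 by presburger
    ultimately show ?thesis using cube_pow by metis
  qed (auto simp: cube_def intro!: exI[of _ 0])
  have axis: "s = 0" if "B * (s * t ^ r) = a * (s ^ r * t)" "t \<noteq> 0" for s t
  proof (rule ccontr)
    assume "s \<noteq> 0"
    have "x ^ r = x ^ (r - 1) * x" for x :: 'a using pos by (metis Suc_diff_1 power_Suc2)
    then have "B * t ^ (r - 1) * (s * t) = a * s ^ (r - 1) * (s * t)"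
      using that by (simp add: mult_ac)
    then have "B = a * s ^ (r - 1) / t ^ (r - 1)"
      using \<open>s \<noteq> 0\<close> \<open>t \<noteq> 0\<close> by (simp add: field_simps)
    moreover have "3 dvd r - 1" using r3 by presburger
    ultimately have "cube B" using cube_K[OF aQ] cube_mult cube_div cube_pow by metis
    then show False using B_not_cube by blast
  qed
  have noncube: "z = 0" if t: "t ^ Q = t" and z: "w ^ (q + 1) / B * t * z ^ Q = z ^ q" for t w z
  proof (rule ccontr)
    assume "z \<noteq> 0"
    have "w ^ (q + 1) * t * z ^ Q = B * z ^ q" using z B0 by (simp add: field_simps)
    \<comment> \<open>The extra factor \<open>z\<close> makes both exponents of \<open>z\<close>
      divisible by 3.\<close>
    then have "w ^ (q + 1) * t * z ^ (Q + 1) = B * z ^ (q + 1)"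
      by (simp add: mult.assoc[symmetric] mult.commute[of _ z])
    then have "B = w ^ (q + 1) * t * z ^ (Q + 1) / z ^ (q + 1)"
      using \<open>z \<noteq> 0\<close> by (simp add: field_simps)
    moreover have "3 dvd q + 1" "3 dvd Q + 1" using q3 Q3 by presburger+
    ultimately have "cube B" using cube_K[OF t] cube_mult cube_div cube_pow by metis
    then show False using B_not_cube by blast
  qed

  \<comment> \<open>The kernel of the polarization of \<open>F\<close>\<close>
  define P :: "'a \<times> 'a \<Rightarrow> 'a \<times> 'a \<Rightarrow> 'a \<times> 'a" where
    "P = (\<lambda>(x, y) (u, v). (x ^ q * u + x * u ^ q + B * (y ^ q * v + y * v ^ q),
       x ^ r * v + u ^ r * y + (a / B) * (x * v ^ r + u * y ^ r)))"
  show ?thesis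
  proof (rule apn_if_polarization_kernel_trivial[of F P])
    show "p + p = 0" for p :: "'a \<times> 'a" by (cases p) (simp add: dbl zero_prod_def)
    show "F (p + h) = F p + F h + P p h" for p h
      by (cases p; cases h) (simp add: assms(16) P_def add_q add_r algebra_simps add_divide_distrib)
    show "P (p + h) c = P p c + P h c" for p h c
      by (cases p; cases h; cases c)
        (simp add: P_def add_q add_r algebra_simps add_divide_distrib)
  next
    fix c p :: "'a \<times> 'a"
    assume c: "c \<noteq> 0" and Ppc: "P p c = 0"
    obtain x y u v where pc: "p = (x, y)" "c = (u, v)" by fastforce
    have D1: "x ^ q * u + x * u ^ q + B * (y ^ q * v + y * v ^ q) = 0"
      and D2: "x ^ r * v + u ^ r * y + (a / B) * (x * v ^ r + u * y ^ r) = 0"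
      using Ppc by (auto simp: pc P_def zero_prod_def)
    have D2': "B * (x ^ r * v + u ^ r * y) = a * (x * v ^ r + u * y ^ r)"
    proof -
      have "x ^ r * v + u ^ r * y = (a / B) * (x * v ^ r + u * y ^ r)"
        using D2 by (rule eq_if_sum_0)
      then show ?thesis using B0 by simp
    qed
    have line: "s = 0 \<or> s = t" if "s ^ q * t + s * t ^ q = 0" "t \<noteq> 0" for s t :: 'a
    proof -
      have "s ^ q * t = s * t ^ q" using that(1) by (rule eq_if_sum_0)
      then have "(s / t) ^ q = s / t" using that(2) by (simp add: power_divide field_simps)
      then have "s / t = 0 \<or> s / t = 1" by (rule fix_q)
      then show ?thesis using that(2) by auto
    qed
    consider "v = 0" "u \<noteq> 0" | "u = 0" "v \<noteq> 0" | "u \<noteq> 0" "v \<noteq> 0"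
      using c by (auto simp: pc zero_prod_def)
    then show "p = 0 \<or> p = c"
    proof cases
      case 1
      have "y = 0" using axis[of y u] D2' 1 pos by (simp add: mult_ac)
      then show ?thesis using line[of x u] D1 1 pos by (auto simp: pc zero_prod_def)
    next
      case 2
      have "B * (v * x ^ r) = a * (v ^ r * x)" using D2' 2 pos by (simp add: mult_ac power_0_left)
      then have "x = 0" using axis[of v x] 2 by blast
      then show ?thesis using line[of y v] D1 2 pos B0 by (auto simp: pc zero_prod_def)
    next
      case 3
      \<comment> \<open>This scaling turns \<open>c\<close> into \<open>(1, 1)\<close>.\<close>
      define w \<xi> \<eta> where "w = u / v" and "\<xi> = x / u" and "\<eta> = y / v"
      have w0: "w \<noteq> 0" using 3 by (simp add: w_def)
      have sub: "u = w * v" "x = w * v * \<xi>" "y = v * \<eta>"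
        using 3 by (auto simp: w_def \<xi>_def \<eta>_def)
      define A e where "A = w ^ (q + 1) / B" and "e = w ^ (q + r) / a"
      have "v ^ (q + 1) * (w ^ (q + 1) * (\<xi> ^ q + \<xi>) + B * (\<eta> ^ q + \<eta>)) = 0"
        using D1 unfolding sub by (simp add: power_mult_distrib algebra_simps)
      then have "w ^ (q + 1) * (\<xi> ^ q + \<xi>) + B * (\<eta> ^ q + \<eta>) = 0"
        using 3 by simp
      then have "w ^ (q + 1) * (\<xi> ^ q + \<xi>) = B * (\<eta> ^ q + \<eta>)"
        by (rule eq_if_sum_0)
      then have eq1: "A * (\<xi> ^ q + \<xi>) = \<eta> ^ q + \<eta>" using B0 by (simp add: A_def field_simps)
      \<comment> \<open>The factor \<open>w ^ (q + 1)\<close> is inserted so that division by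
        \<open>a * B\<close> produces \<open>e\<close> and \<open>A\<close> as coefficients.\<close>
      have "v ^ (r + 1) * w * (B * w ^ q * (w ^ r * (\<xi> ^ r + \<eta>)))
          = v ^ (r + 1) * w * (a * w ^ (q + 1) * (\<xi> + \<eta> ^ r))"
        using arg_cong[OF D2', of "\<lambda>t. w ^ (q + 1) * t"] unfolding sub
        by (simp add: power_mult_distrib algebra_simps)
      then have "B * w ^ (q + r) * (\<xi> ^ r + \<eta>) = a * w ^ (q + 1) * (\<xi> + \<eta> ^ r)"
        using 3 w0 by (simp add: power_add mult.assoc)
      then have eq2: "e * ((\<xi> ^ Q) ^ q + \<eta>) = A * (\<xi> + (\<eta> ^ Q) ^ q)"
        using a0 B0 by (simp add: A_def e_def field_simps assms(10) flip: power_mult)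
      \<comment> \<open>The power \<open>w ^ (q + r)\<close> is the product of \<open>w ^ q\<close>
        and its conjugate \<open>w ^ r\<close>, which the power \<open>Q\<close> swaps.\<close>
      have eQ: "e ^ Q = e"
      proof -
        have "(q + r) * Q = Q * Q * q + r" by (simp add: assms(10) algebra_simps)
        then have "w ^ ((q + r) * Q) = ((w ^ Q) ^ Q) ^ q * w ^ r"
          by (simp only: power_mult power_add)
        also have "\<dots> = w ^ (q + r)" by (simp only: QQ power_add)
        finally have "(w ^ (q + r)) ^ Q = w ^ (q + r)" by (simp only: power_mult)
        then show ?thesis by (simp only: e_def power_divide aQ)
      qed
      have generic: "(A * A ^ Q) ^ q \<noteq> e ^ q * e"
      proof
        assume "(A * A ^ Q) ^ q = e ^ q * e"
        moreover have "(A * A ^ Q) ^ q = A ^ (q + r)"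
        proof -
          have "(A * A ^ Q) ^ q = A ^ q * A ^ (Q * q)"
            by (simp only: power_mult_distrib power_mult)
          then show ?thesis by (simp only: assms(10) power_add mult.commute[of Q])
        qed
        ultimately have "A ^ (q + r) = e ^ (q + 1)" by simp
        \<comment> \<open>Both sides carry the same power of \<open>w\<close>, leaving exactly the
          excluded equality of \<open>B ^ (q + r)\<close> and \<open>a ^ (q + 1)\<close>.\<close>
        then have "w ^ ((q + r) * (q + 1)) / B ^ (q + r) = w ^ ((q + r) * (q + 1)) / a ^ (q + 1)"
          by (simp only: A_def e_def power_divide mult.commute flip: power_mult)
        then have "B ^ (q + r) = a ^ (q + 1)" using w0 a0 B0 by (simp add: divide_simps)
        then show False using assms(15) by blast
      qed
      have "\<xi> ^ q = \<xi> \<and> \<eta> = \<xi> ^ Q"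
        using conjugate_system_trivial[of "\<lambda>x. x ^ q" "\<lambda>x. x ^ Q" e A \<xi> \<eta>] two add_q add_Q QQ eQ
          generic eq1 eq2 noncube[of _ w] pos w0 a0
        by (simp add: power_mult_distrib A_def e_def mult.commute flip: power_mult)
      then have "(\<xi> = 0 \<and> \<eta> = 0) \<or> (\<xi> = 1 \<and> \<eta> = 1)" using fix_q[of \<xi>] pos by auto
      then show ?thesis unfolding pc sub by (auto simp: zero_prod_def)
    qed
  qed
qed

end
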